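(* Let $Q$ be a connected quiver. The following are equivalent. (1) $Q$ has no oriented cycles, and for a certain vertex $x\in Q$ the round trip distance spheres $S_Q(x,n)$ are finite for all $n\in\mathbb{N}$; or, equivalently, (1') $Q$ has no oriented cycles, and for all vertices $x\in Q$ the round trip distance spheres $S_Q(x,n)$ are finite for all $n\in\mathbb{N}$. (2) For any two vertices of $\mathbb{Z}Q$ there are only finitely many paths in $\mathbb{Z}Q$ between them. (3) The translation quiver $\mathbb{Z}Q$ has a strongly locally finite section.
   Context: $\mathbb{N}=\{0,1,2,\dots\}$. A quiver $Q$ consists of a set of vertices and a set of arrows between them (possibly infinite; loops and multiple arrows allowed); $x\in Q$ means $x$ is a vertex. A connected quiver is nonempty. A path from $x$ to $y$ is a sequence of vertices $x=x_0,x_1,\dots,x_m=y$ ($m\ge 0$) such that there is an arrow $x_i\to x_{i+1}$ for all $i<m$; it is trivial if $m=0$. An oriented cycle is a nontrivial path from a vertex to itself. In an unoriented path each step traverses an arrow either in its direction or in the opposite direction. Round trip distance: for vertices $x,y$ of $Q$, $d_Q(x,y)$ is the least number of arrows that have to be traversed in the opposite direction on an unoriented path from $x$ to $y$ and back to $x$. The round trip distance spheres are $S_Q(x,n)=\{y\in Q\mid d_Q(x,y)=n\}$. The stable translation quiver $\mathbb{Z}Q$ has vertices $(n,x)$ with $n\in\mathbb{Z}$, $x\in Q$. The number of arrows $(i,x)\to(j,y)$ equals the number of arrows $x\to y$ in $Q$ if $i=j$, the number of arrows $y\to x$ in $Q$ if $j=i+1$, and zero otherwise. The translation is $\tau(n,x)=(n-1,x)$.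 A section of $\mathbb{Z}Q$ is a full subquiver $Q'$ of $\mathbb{Z}Q$ such that the embedding $Q'\to\mathbb{Z}Q$ extends (along $Q'\to\mathbb{Z}Q'$, $x\mapsto(0,x)$) to an isomorphism $\mathbb{Z}Q'\to\mathbb{Z}Q$ of stable translation quivers, i.e. an isomorphism of quivers commuting with the translations. A connected quiver is strongly locally finite if every vertex has only finitely many neighbors (vertices joined to it by an arrow in some direction) and there are no infinite sequences $a_0\to a_1\to a_2\to\cdots$ or $\cdots\to a_2\to a_1\to a_0$ of consecutive arrows (vertices need not be distinct; in particular there are no oriented cycles). *)

theory Defs
  imports "Graph_Theory.Vertex_Walk" "Graph_Theory.Digraph_Isomorphism"
begin

text \<open>
  A quiver is a \<open>pre_digraph\<close> satisfying \<open>wf_digraph\<close>: loops, multiple arrows and infinite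
  sets of vertices or arrows are allowed.  \<open>connected\<close> includes nonemptiness.  Paths are
  sequences of vertices (\<open>vwalk\<close>), so parallel arrows do not give different paths.
\<close>

definition paths :: "('a,'b) pre_digraph \<Rightarrow> 'a \<Rightarrow> 'a \<Rightarrow> 'a list set" where
  "paths Q x y = {p. vwalk p Q \<and> hd p = x \<and> last p = y}"

text \<open>
  The library's \<open>pre_digraph.cycle\<close> additionally forbids repeated vertices, so it is not used here.
\<close>

definition oriented_cycle :: "('a,'b) pre_digraph \<Rightarrow> 'a list \<Rightarrow> bool" where
  "oriented_cycle Q p \<longleftrightarrow> (\<exists>x. p \<in> paths Q x x) \<and> vwalk_length p > 0"

text \<open>
  An unoriented path in \<open>Q\<close> is an arc walk in \<open>double_quiver Q\<close>, in which \<open>(a, True)\<close> is the arrow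
  \<open>a\<close> traversed in its direction and \<open>(a, False)\<close> is \<open>a\<close> traversed in the opposite direction.
\<close>

definition double_quiver :: "('a,'b) pre_digraph \<Rightarrow> ('a, 'b \<times> bool) pre_digraph" where
  "double_quiver Q = \<lparr> verts = verts Q, arcs = arcs Q \<times> UNIV,
     tail = (\<lambda>(a, fwd). if fwd then tail Q a else head Q a),
     head = (\<lambda>(a, fwd). if fwd then head Q a else tail Q a) \<rparr>"

definition opposite_steps :: "('b \<times> bool) list \<Rightarrow> nat" where
  "opposite_steps p = length (filter (\<lambda>(a, fwd). \<not> fwd) p)"

text \<open>
  If no unoriented path joins \<open>x\<close> and \<open>y\<close>, the value is meaningless; in a connected quiver this
  does not happen for vertices.
\<close>

definition round_trip_dist :: "('a,'b) pre_digraph \<Rightarrow> 'a \<Rightarrow> 'a \<Rightarrow> nat" where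
  "round_trip_dist Q x y =
     (LEAST k. \<exists>p q. pre_digraph.awalk (double_quiver Q) x p y \<and>
                     pre_digraph.awalk (double_quiver Q) y q x \<and>
                     opposite_steps (p @ q) = k)"

definition round_trip_sphere :: "('a,'b) pre_digraph \<Rightarrow> 'a \<Rightarrow> nat \<Rightarrow> 'a set" where
  "round_trip_sphere Q x n = {y \<in> verts Q. round_trip_dist Q x y = n}"

text \<open>
  An arrow \<open>a : x \<rightarrow> y\<close> of \<open>Q\<close> gives for every integer \<open>i\<close> an arrow
  \<open>Level i a : (i, x) \<rightarrow> (i, y)\<close> and an arrow \<open>Cross i a : (i, y) \<rightarrow> (i + 1, x)\<close> of \<open>\<int>Q\<close>.
\<close>

datatype 'b zarrow = Level int 'b | Cross int 'b

definition ZQ :: "('a,'b) pre_digraph \<Rightarrow> (int \<times> 'a, 'b zarrow) pre_digraph" where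
  "ZQ Q = \<lparr> verts = UNIV \<times> verts Q,
     arcs = {Level i a | i a. a \<in> arcs Q} \<union> {Cross i a | i a. a \<in> arcs Q},
     tail = (\<lambda>e. case e of Level i a \<Rightarrow> (i, tail Q a) | Cross i a \<Rightarrow> (i, head Q a)),
     head = (\<lambda>e. case e of Level i a \<Rightarrow> (i, head Q a) | Cross i a \<Rightarrow> (i + 1, tail Q a)) \<rparr>"

fun translation :: "int \<times> 'a \<Rightarrow> int \<times> 'a" where
  "translation (n, x) = (n - 1, x)"

definition translation_quiver_isomorphism ::
  "('a,'b) pre_digraph \<Rightarrow> ('c,'d) pre_digraph \<Rightarrow>
   (int \<times> 'a, 'b zarrow, int \<times> 'c, 'd zarrow) digraph_isomorphism \<Rightarrow> bool" where
  "translation_quiver_isomorphism Q R f \<longleftrightarrow>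
     pre_digraph.digraph_isomorphism (ZQ Q) f \<and> app_iso f (ZQ Q) = ZQ R \<and>
     (\<forall>v \<in> verts (ZQ Q). iso_verts f (translation v) = translation (iso_verts f v))"

text \<open>
  The last two conjuncts say that \<open>f : \<int>Q' \<rightarrow> \<int>Q\<close> extends the embedding of \<open>Q'\<close> into \<open>\<int>Q\<close> along
  \<open>Q' \<rightarrow> \<int>Q'\<close>, on vertices and on arrows.
\<close>

definition is_section :: "('a,'b) pre_digraph \<Rightarrow> (int \<times> 'a, 'b zarrow) pre_digraph \<Rightarrow> bool" where
  "is_section Q Q' \<longleftrightarrow> induced_subgraph Q' (ZQ Q) \<and>
     (\<exists>f. translation_quiver_isomorphism Q' Q f \<and>
          (\<forall>v \<in> verts Q'. iso_verts f (0, v) = v) \<and>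
          (\<forall>a \<in> arcs Q'. iso_arcs f (Level 0 a) = a))"

text \<open>Only the number of neighbours is restricted, not the number of arrows to each of them.\<close>

definition strongly_locally_finite :: "('a,'b) pre_digraph \<Rightarrow> bool" where
  "strongly_locally_finite Q \<longleftrightarrow> connected Q \<and>
     (\<forall>x \<in> verts Q. finite {y. x \<rightarrow>\<^bsub>Q\<^esub> y \<or> y \<rightarrow>\<^bsub>Q\<^esub> x}) \<and>
     \<not> (\<exists>a :: nat \<Rightarrow> 'a. \<forall>i. a i \<rightarrow>\<^bsub>Q\<^esub> a (Suc i)) \<and>
     \<not> (\<exists>a :: nat \<Rightarrow> 'a. \<forall>i. a (Suc i) \<rightarrow>\<^bsub>Q\<^esub> a i)"

end

theory Submission
  imports Defs
begin

text \<open>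
  An unoriented path from \<open>x\<close> to \<open>y\<close> with \<open>n\<close> opposite steps is the same thing as a path
  in \<open>\<int>Q\<close> from \<open>(i, x)\<close> to \<open>(i + n, y)\<close> (\<open>reachable_ZQ_iff_awalk\<close>). So, with \<open>c x y\<close> the
  least number of opposite steps needed to get from \<open>x\<close> to \<open>y\<close> (\<open>opposite_dist\<close>), the
  round trip distance is \<open>c x y + c y x\<close>, and reachability in \<open>\<int>Q\<close> is controlled by \<open>c\<close>.

  The conditions on spheres and the one on paths all say that \<open>Q\<close> has no oriented cycles
  and that \<open>\<int>Q\<close> has finite intervals: between two given vertices of \<open>\<int>Q\<close> there are only
  finitely many vertices. For the paths this is \<open>finite_paths_ZQ_iff\<close>: in an acyclic
  quiver a path repeats no vertex, so finitely many vertices in between allow only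
  finitely many paths. For the spheres: if \<open>y\<close> has distance \<open>n\<close> from \<open>x\<close>, a copy of \<open>y\<close>
  lies between \<open>(0, x)\<close> and \<open>(n, x)\<close>; conversely, by the triangle inequality for \<open>c\<close>,
  the vertices of \<open>Q\<close> that occur in an interval of \<open>\<int>Q\<close> lie in a ball around any fixed
  vertex.

  Sections arise from height functions: if \<open>h y \<le> h x \<le> h y + 1\<close> for every arrow \<open>x \<rightarrow> y\<close>
  of \<open>Q\<close>, then the pairs \<open>(h x, x)\<close> are the vertices of a section
  (\<open>is_section_graph_section\<close>). For a base vertex \<open>b\<close>, the function \<open>c b x\<close> is the
  lowest level at which \<open>x\<close> is a successor of \<open>(0, b)\<close>, and \<open>- c x b\<close> is the highest
  level at which it is a predecessor. Both are height functions, but the first section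
  may contain infinite paths leaving \<open>b\<close> and the second infinite paths entering it.
  Their rounded mean \<open>midway b\<close> is again a height function. If a path of its section
  leads from a fixed vertex to \<open>(h y, y)\<close>, then \<open>c b y\<close> exceeds \<open>h y\<close> by at most a
  constant; as \<open>h y\<close> is about \<open>(c b y - c y b) / 2\<close>, this bounds \<open>c b y + c y b\<close>, so \<open>y\<close>
  lies in a fixed ball. The same happens for paths that lead to a fixed vertex. Since
  balls are finite, an infinite path would have to repeat a vertex
  (\<open>finite_midway_reach\<close>, \<open>strongly_locally_finite_midway\<close>).

  Conversely, given a strongly locally finite section \<open>Q'\<close>, it suffices to count paths
  in \<open>\<int>Q'\<close>. Along a path to a vertex of level \<open>n\<close>, every arrow either lowers the number
  of levels left to climb or follows an arrow of \<open>Q'\<close>. As \<open>Q'\<close> has no infinite forward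
  path this is a well-founded descent, and as each vertex has finitely many neighbours,
  the paths are finite in number by well-founded induction
  (\<open>finite_paths_ZQ_if_strongly_locally_finite\<close>).
\<close>

section \<open>Paths in quivers\<close>

lemma chain_range_infinite:
  fixes a :: "nat \<Rightarrow> 'a"
  assumes "acyclic r" and chain: "\<And>i. (a i, a (Suc i)) \<in> r"
  shows "infinite (range a)"
proof -
  have "(a i, a j) \<in> r\<^sup>+" if "i < j" for i j
    using that
  proof (induct rule: less_Suc_induct)
    case (1 i)
    show ?case using chain by blast
  next
    case (2 i j k)
    then show ?case by (auto intro: trancl_trans)
  qed
  with \<open>acyclic r\<close> have "inj a"
    unfolding acyclic_def by (metis injI linorder_neqE_nat)
  then show ?thesis by (rule range_inj_infinite)
qed

lemma paths_join:
  assumes "p \<in> paths G u w" and "q \<in> paths G w v"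
  shows "p \<oplus> q \<in> paths G u v"
proof -
  from assms have "p \<noteq> []" "q \<noteq> []" "last p = hd q" and "vwalk p G" "vwalk q G"
    by (auto simp: paths_def)
  then have "vwalk (p \<oplus> q) G" "last (p \<oplus> q) = last q"
    by (auto intro: vwalk_joinI_vwalk simp: vwalk_join_last)
  moreover have "hd (p \<oplus> q) = hd p"
    using \<open>p \<noteq> []\<close> by (simp add: vwalk_join_def)
  ultimately show ?thesis
    using assms by (auto simp: paths_def)
qed

lemma paths_Cons_subset:
  assumes "p \<in> paths G u v"
  shows "p = [u] \<or> (\<exists>w q. u \<rightarrow>\<^bsub>G\<^esub> w \<and> q \<in> paths G w v \<and> p = u # q)"
proof (cases p)
  case Nil
  with assms show ?thesis by (auto simp: paths_def)
next
  case (Cons x q)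
  show ?thesis
  proof (cases "q = []")
    case True
    with assms Cons show ?thesis by (auto simp: paths_def)
  next
    case False
    from assms Cons have "vwalk (x # q) G" by (auto simp: paths_def)
    then have "(x, hd q) \<in> arcs_ends G \<and> vwalk q G"
      using False by (auto elim: vwalk_consE)
    with assms Cons False show ?thesis by (auto simp: paths_def)
  qed
qed

lemma vwalk_reachable1:
  assumes "vwalk (x # p) G" and "y \<in> set p"
  shows "x \<rightarrow>\<^sup>+\<^bsub>G\<^esub> y"
  using assms
proof (induct p arbitrary: x)
  case (Cons z p)
  then have "x \<rightarrow>\<^bsub>G\<^esub> z" and "vwalk (z # p) G"
    by (auto elim: vwalk_consE)
  with Cons show ?case
    by (auto intro: trancl_into_trancl2)
qed simp

lemma acyclic_imp_distinct_vwalk: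
  assumes "acyclic (arcs_ends G)" and "vwalk p G"
  shows "distinct p"
  using assms(2)
proof (induct p rule: list.induct)
  case (Cons x p)
  have "x \<notin> set p"
    using vwalk_reachable1[OF Cons.prems, of x] assms(1) by (auto simp: acyclic_def)
  moreover have "distinct p"
    using Cons by (cases "p = []") (auto elim: vwalk_consE)
  ultimately show ?case by simp
qed simp

context wf_digraph
begin

lemma reachable_iff_paths: "u \<rightarrow>\<^sup>* v \<longleftrightarrow> paths G u v \<noteq> {}"
  by (auto simp: reachable_vwalk_conv paths_def)

lemma reachable1_nontrivial_path:
  assumes "u \<rightarrow>\<^sup>+ v"
  obtains p where "p \<in> paths G u v" and "length p > 1"
proof -
  from assms obtain w where "u \<rightarrow>\<^bsub>G\<^esub> w" "w \<rightarrow>\<^sup>* v"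
    by (cases rule: converse_tranclE) (auto intro: adj_in_verts)
  then obtain q where q: "q \<in> paths G w v"
    by (auto simp: reachable_iff_paths)
  with \<open>u \<rightarrow>\<^bsub>G\<^esub> w\<close> have "u # q \<in> paths G u v"
    by (auto simp: paths_def intro: vwalk_wf_digraph_consI)
  moreover have "length (u # q) > 1"
    using q by (auto simp: paths_def)
  ultimately show thesis by (rule that)
qed

lemma ex_oriented_cycle_iff: "(\<exists>p. oriented_cycle G p) \<longleftrightarrow> \<not> acyclic (arcs_ends G)"
proof
  assume "\<exists>p. oriented_cycle G p"
  then obtain p x where p: "p \<in> paths G x x" "vwalk_length p > 0"
    by (auto simp: oriented_cycle_def)
  then obtain y q where "p = y # q" "q \<noteq> []" by (cases p) auto
  with p have "vwalk (x # q) G" "x \<in> set q"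
    by (auto simp: paths_def)
  then show "\<not> acyclic (arcs_ends G)"
    by (auto simp: acyclic_def dest: vwalk_reachable1)
next
  assume "\<not> acyclic (arcs_ends G)"
  then obtain x where "x \<rightarrow>\<^sup>+ x" by (auto simp: acyclic_def)
  then obtain p where "p \<in> paths G x x" "length p > 1"
    by (rule reachable1_nontrivial_path)
  then show "\<exists>p. oriented_cycle G p"
    by (auto simp: oriented_cycle_def)
qed

text \<open>
  A longest path from \<open>u\<close> to itself could be prolonged by a cycle at \<open>u\<close>, and every vertex between
  \<open>u\<close> and \<open>v\<close> lies on a path from \<open>u\<close> to \<open>v\<close>.  Conversely, without cycles a path is a repetition-free
  list of vertices between its ends.
\<close>
lemma finite_paths_iff:
  "(\<forall>u \<in> verts G. \<forall>v \<in> verts G. finite (paths G u v)) \<longleftrightarrow>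
   acyclic (arcs_ends G) \<and>
   (\<forall>u \<in> verts G. \<forall>v \<in> verts G. finite {w. u \<rightarrow>\<^sup>* w \<and> w \<rightarrow>\<^sup>* v})"
  (is "?P \<longleftrightarrow> ?A \<and> ?I")
proof (intro iffI conjI)
  assume ?P
  show ?A
  proof (rule ccontr)
    assume "\<not> ?A"
    then obtain u where "u \<rightarrow>\<^sup>+ u" by (auto simp: acyclic_def)
    then obtain c where c: "c \<in> paths G u u" "length c > 1"
      by (rule reachable1_nontrivial_path)
    from \<open>u \<rightarrow>\<^sup>+ u\<close> have "finite (paths G u u)"
      using \<open>?P\<close> reachable1_in_verts by blast
    define N where "N = Max (length ` paths G u u)"
    have "N \<in> length ` paths G u u"
      unfolding N_def using c \<open>finite (paths G u u)\<close> by (intro Max_in) auto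
    then obtain p where p: "p \<in> paths G u u" "length p = N" by auto
    have "c \<oplus> p \<in> paths G u u" using c p by (auto intro: paths_join)
    then have "length (c \<oplus> p) \<le> N"
      unfolding N_def using \<open>finite (paths G u u)\<close> by auto
    moreover have "length (c \<oplus> p) > N"
      using c p by (auto simp: vwalk_join_def)
    ultimately show False by simp
  qed
  show ?I
  proof (intro ballI)
    fix u v assume "u \<in> verts G" "v \<in> verts G"
    have "{w. u \<rightarrow>\<^sup>* w \<and> w \<rightarrow>\<^sup>* v} \<subseteq> (\<Union>p \<in> paths G u v. set p)"
    proof clarify
      fix w assume "u \<rightarrow>\<^sup>* w" "w \<rightarrow>\<^sup>* v"
      then obtain p q where pq: "p \<in> paths G u w" "q \<in> paths G w v"
        by (auto simp: reachable_iff_paths)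
      then have "w \<in> set (p \<oplus> q)"
        by (auto simp: paths_def vwalk_join_def vwalk_def)
      with paths_join[OF pq] show "w \<in> (\<Union>p \<in> paths G u v. set p)" by blast
    qed
    moreover have "finite (paths G u v)"
      using \<open>?P\<close> \<open>u \<in> verts G\<close> \<open>v \<in> verts G\<close> by blast
    ultimately show "finite {w. u \<rightarrow>\<^sup>* w \<and> w \<rightarrow>\<^sup>* v}"
      by (auto intro: finite_subset)
  qed
next
  assume "?A \<and> ?I"
  show ?P
  proof (intro ballI)
    fix u v assume uv: "u \<in> verts G" "v \<in> verts G"
    let ?W = "{w. u \<rightarrow>\<^sup>* w \<and> w \<rightarrow>\<^sup>* v}"
    have "paths G u v \<subseteq> {p. set p \<subseteq> ?W \<and> distinct p}"
    proof (rule subsetI, rule CollectI, rule conjI)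
      fix p assume p: "p \<in> paths G u v"
      then show "distinct p"
        using \<open>?A \<and> ?I\<close> by (auto simp: paths_def intro: acyclic_imp_distinct_vwalk)
      show "set p \<subseteq> ?W"
      proof
        fix w assume "w \<in> set p"
        then obtain q r where qr: "p = q \<oplus> r" "last q = w" "hd r = w" "q \<noteq> []" "r \<noteq> []"
          using vwalk_join_split by meson
        then have "joinable q r" by simp
        moreover have "vwalk q G" "vwalk r G"
          using vwalkI_vwalk_join_l[of q r G] vwalkI_vwalk_join_r[of q r G] qr p \<open>joinable q r\<close>
          by (simp_all add: paths_def)
        ultimately have "q \<in> paths G u w" "r \<in> paths G w v"
          using qr p by (auto simp: paths_def vwalk_join_hd vwalk_join_last)
        then show "w \<in> ?W" by (auto simp: reachable_iff_paths)
      qed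
    qed
    moreover have "finite ?W" using \<open>?A \<and> ?I\<close> uv by blast
    ultimately show "finite (paths G u v)"
      using finite_subset_distinct finite_subset by blast
  qed
qed

text \<open>
  Finite branching and well-foundedness give finitely many paths: a nontrivial path from \<open>u\<close> is a
  choice of a successor \<open>w\<close> followed by a path from \<open>w\<close>.
\<close>
lemma finite_paths_if_wf:
  assumes "wf {(w, u). u \<rightarrow>\<^bsub>G\<^esub> w \<and> w \<rightarrow>\<^sup>* v}"
    and "\<And>u. u \<in> verts G \<Longrightarrow> finite {w. u \<rightarrow>\<^bsub>G\<^esub> w}"
    and "u \<in> verts G"
  shows "finite (paths G u v)"
  using assms(1,3)
proof (induct u rule: wf_induct_rule)
  case (less u)
  let ?W = "{w. u \<rightarrow>\<^bsub>G\<^esub> w \<and> w \<rightarrow>\<^sup>* v}"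
  have "paths G u v \<subseteq> {[u]} \<union> (\<Union>w \<in> ?W. (#) u ` paths G w v)"
  proof
    fix p assume "p \<in> paths G u v"
    from paths_Cons_subset[OF this]
    show "p \<in> {[u]} \<union> (\<Union>w \<in> ?W. (#) u ` paths G w v)"
      using reachable_iff_paths by blast
  qed
  moreover have "finite ?W"
    using assms(2)[OF less.prems] by (rule rev_finite_subset) blast
  moreover have "finite (paths G w v)" if "w \<in> ?W" for w
    using that by (intro less.hyps) (auto intro: adj_in_verts)
  ultimately show ?case
    by (auto intro: finite_subset)
qed

text \<open>
  The vertex lists have to be lifted step by step: the arrow under a step of \<open>p\<close> is only
  known up to \<open>f\<close>, and injectivity on the vertices makes consecutive lifted steps match.
\<close>
lemma vwalk_app_isoE:
  assumes iso: "digraph_isomorphism f" and p: "vwalk p (app_iso f G)"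
  obtains q where "vwalk q G" and "p = map (iso_verts f) q"
proof -
  have "\<exists>q. vwalk q G \<and> p = map (iso_verts f) q"
    using p
  proof (induct p rule: vwalk_induct)
    case (Base u)
    then obtain v where "v \<in> verts G" "u = iso_verts f v" by auto
    then have "vwalk [v] G \<and> [u] = map (iso_verts f) [v]" by (auto simp: vwalk_def)
    then show ?case by (rule exI)
  next
    case (Cons u v es)
    from Cons(2) obtain q where q: "vwalk q G" "v # es = map (iso_verts f) q" by (elim exE conjE)
    from Cons(1) obtain a b where ab: "a \<rightarrow>\<^bsub>G\<^esub> b" "u = iso_verts f a" "v = iso_verts f b"
      by (auto simp: arcs_ends_app_iso_eq[OF iso])
    from q obtain c r where "q = c # r" "v = iso_verts f c" by (cases q) auto
    moreover from this q have "c \<in> verts G" by (simp add: vwalk_def)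
    moreover have "b \<in> verts G" using ab adj_in_verts by blast
    ultimately have "hd q = b" using ab iso by simp
    then have "vwalk (a # q) G"
      using q(1) ab(1) by (simp add: vwalk_wf_digraph_consI)
    moreover have "u # v # es = map (iso_verts f) (a # q)"
      using q(2) ab(2) by simp
    ultimately show ?case by (intro exI conjI)
  qed
  then show thesis by (elim exE conjE that)
qed

lemma finite_paths_app_iso:
  assumes iso: "digraph_isomorphism f"
    and "u \<in> verts G" and "v \<in> verts G" and "finite (paths G u v)"
  shows "finite (paths (app_iso f G) (iso_verts f u) (iso_verts f v))"
proof -
  have "paths (app_iso f G) (iso_verts f u) (iso_verts f v) \<subseteq> map (iso_verts f) ` paths G u v"
  proof
    fix p assume p: "p \<in> paths (app_iso f G) (iso_verts f u) (iso_verts f v)"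
    then obtain q where q: "vwalk q G" "p = map (iso_verts f) q"
      using iso by (auto simp: paths_def elim: vwalk_app_isoE)
    then have "q \<noteq> []" "hd q \<in> verts G" "last q \<in> verts G"
      by (auto simp: vwalk_def subset_iff)
    with p q have "hd q = u" "last q = v"
      using assms by (auto simp: paths_def hd_map last_map)
    with q show "p \<in> map (iso_verts f) ` paths G u v" by (auto simp: paths_def)
  qed
  with assms(4) show ?thesis by (auto intro: finite_subset)
qed

end

section \<open>Reachability in the translation quiver\<close>

context wf_digraph
begin

lemma wf_digraph_ZQ: "wf_digraph (ZQ G)"
  by unfold_locales (auto simp: ZQ_def)

lemma wf_digraph_double_quiver: "wf_digraph (double_quiver G)"
  by unfold_locales (auto simp: double_quiver_def split: if_splits)

lemma double_quiver_simps [simp]: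
  "verts (double_quiver G) = verts G"
  "(a, fwd) \<in> arcs (double_quiver G) \<longleftrightarrow> a \<in> arcs G"
  "tail (double_quiver G) (a, fwd) = (if fwd then tail G a else head G a)"
  "head (double_quiver G) (a, fwd) = (if fwd then head G a else tail G a)"
  by (simp_all add: double_quiver_def)

lemma verts_ZQ_iff [simp]: "(i, x) \<in> verts (ZQ G) \<longleftrightarrow> x \<in> verts G"
  by (simp add: ZQ_def)

lemma arcs_ZQ_iff [simp]:
  "Level i a \<in> arcs (ZQ G) \<longleftrightarrow> a \<in> arcs G"
  "Cross i a \<in> arcs (ZQ G) \<longleftrightarrow> a \<in> arcs G"
  by (auto simp: ZQ_def)

lemma ends_ZQ [simp]:
  "tail (ZQ G) (Level i a) = (i, tail G a)"
  "head (ZQ G) (Level i a) = (i, head G a)"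
  "tail (ZQ G) (Cross i a) = (i, head G a)"
  "head (ZQ G) (Cross i a) = (i + 1, tail G a)"
  by (simp_all add: ZQ_def)

lemma adj_ZQ_iff:
  "(i, x) \<rightarrow>\<^bsub>ZQ G\<^esub> (j, y) \<longleftrightarrow>
   j = i \<and> x \<rightarrow>\<^bsub>G\<^esub> y \<or> j = i + 1 \<and> y \<rightarrow>\<^bsub>G\<^esub> x"
  by (force simp: arcs_ends_conv image_iff ZQ_def)

lemma reachable_ZQ_shift:
  assumes "(i, x) \<rightarrow>\<^sup>*\<^bsub>ZQ G\<^esub> (j, y)"
  shows "(i + k, x) \<rightarrow>\<^sup>*\<^bsub>ZQ G\<^esub> (j + k, y)"
proof -
  interpret Z: wf_digraph "ZQ G" by (rule wf_digraph_ZQ)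
  show ?thesis
    using assms
  proof (induct "(i, x)" arbitrary: i x rule: Z.converse_reachable_induct)
    case base
    then show ?case by simp
  next
    case (step v)
    obtain i' x' where v: "v = (i', x')" by fastforce
    from step v have "(i + k, x) \<rightarrow>\<^bsub>ZQ G\<^esub> (i' + k, x')"
      by (auto simp: adj_ZQ_iff)
    also from step v have "(i' + k, x') \<rightarrow>\<^sup>*\<^bsub>ZQ G\<^esub> (j + k, y)" by blast
    finally show ?case .
  qed
qed

text \<open>
  No arrow of \<open>\<int>Q\<close> lowers the level, and those that keep it are copies of arrows of \<open>Q\<close>.
\<close>
lemma reachable1_ZQ_level:
  assumes "(i, x) \<rightarrow>\<^sup>+\<^bsub>ZQ G\<^esub> (j, y)"
  shows "i < j \<or> i = j \<and> x \<rightarrow>\<^sup>+\<^bsub>G\<^esub> y"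
  using assms
proof (induct "(j, y)" arbitrary: j y rule: trancl_induct)
  case base
  then show ?case by (auto simp: adj_ZQ_iff)
next
  case (step v)
  obtain k z where "v = (k, z)" by fastforce
  with step show ?case by (fastforce simp: adj_ZQ_iff)
qed

lemma reachable_ZQ_level:
  assumes "(i, x) \<rightarrow>\<^sup>*\<^bsub>ZQ G\<^esub> (j, y)"
  shows "i \<le> j"
proof (cases "(i, x) = (j, y)")
  case False
  with assms have "(i, x) \<rightarrow>\<^sup>+\<^bsub>ZQ G\<^esub> (j, y)"
    by (rule wf_digraph.reachable_neq_reachable1[OF wf_digraph_ZQ])
  from reachable1_ZQ_level[OF this] show ?thesis by auto
qed simp

lemma reachable1_ZQ_Level: "x \<rightarrow>\<^sup>+\<^bsub>G\<^esub> y \<Longrightarrow> (i, x) \<rightarrow>\<^sup>+\<^bsub>ZQ G\<^esub> (i, y)"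
  by (induct rule: trancl_induct) (auto simp: adj_ZQ_iff intro: trancl_into_trancl)

text \<open>A cycle in \<open>\<int>Q\<close> cannot raise the level, so it is a copy of a cycle in \<open>Q\<close>.\<close>
lemma acyclic_ZQ_iff: "acyclic (arcs_ends (ZQ G)) \<longleftrightarrow> acyclic (arcs_ends G)"
proof -
  have "(i, x) \<rightarrow>\<^sup>+\<^bsub>ZQ G\<^esub> (i, x) \<longleftrightarrow> x \<rightarrow>\<^sup>+\<^bsub>G\<^esub> x" for i x
    using reachable1_ZQ_level[of i x i x] reachable1_ZQ_Level[of x x i] by auto
  then show ?thesis by (simp add: acyclic_def)
qed

text \<open>
  A level arrow of \<open>\<int>Q\<close> is an arrow of \<open>Q\<close> traversed forwards, a crossing arrow is one traversed
  backwards, so the level counts the opposite steps.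
\<close>
lemma reachable_ZQ_iff_awalk:
  "(i, x) \<rightarrow>\<^sup>*\<^bsub>ZQ G\<^esub> (j, y) \<longleftrightarrow>
   (\<exists>p. pre_digraph.awalk (double_quiver G) x p y \<and> j = i + int (opposite_steps p))"
  (is "_ \<longleftrightarrow> (\<exists>p. ?walk i x p)")
proof -
  interpret Z: wf_digraph "ZQ G" by (rule wf_digraph_ZQ)
  interpret D: wf_digraph "double_quiver G" by (rule wf_digraph_double_quiver)
  show ?thesis
  proof
    assume "(i, x) \<rightarrow>\<^sup>*\<^bsub>ZQ G\<^esub> (j, y)"
    then show "\<exists>p. ?walk i x p"
    proof (induct "(i, x)" arbitrary: i x rule: Z.converse_reachable_induct)
      case base
      then have "?walk j y []"
        by (simp add: D.awalk_Nil_iff opposite_steps_def)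
      then show ?case by (rule exI)
    next
      case (step v)
      obtain i' x' where v: "v = (i', x')" by fastforce
      with step obtain p where p: "?walk i' x' p" by blast
      from step.hyps(1) v consider
        a where "i' = i" "a \<in> arcs G" "tail G a = x" "head G a = x'"
        | a where "i' = i + 1" "a \<in> arcs G" "tail G a = x'" "head G a = x"
        by (auto simp: adj_ZQ_iff)
      then show ?case
      proof cases
        case (1 a)
        with p have "?walk i x ((a, True) # p)"
          by (simp add: D.awalk_Cons_iff opposite_steps_def)
        then show ?thesis by (rule exI)
      next
        case (2 a)
        with p have "?walk i x ((a, False) # p)"
          by (simp add: D.awalk_Cons_iff opposite_steps_def)
        then show ?thesis by (rule exI)
      qed
    qed
  next
    assume "\<exists>p. ?walk i x p"
    then obtain p where "?walk i x p" ..
    then show "(i, x) \<rightarrow>\<^sup>*\<^bsub>ZQ G\<^esub> (j, y)"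
    proof (induct p arbitrary: i x)
      case Nil
      then have "x = y" "x \<in> verts G" "i = j"
        by (auto simp: D.awalk_Nil_iff opposite_steps_def)
      then show ?case by simp
    next
      case (Cons e p)
      obtain a fwd where e: "e = (a, fwd)" by fastforce
      define i' where "i' = (if fwd then i else i + 1)"
      let ?x' = "head (double_quiver G) e"
      from Cons.prems e have a: "a \<in> arcs G" and "x = tail (double_quiver G) e"
        by (simp_all add: D.awalk_Cons_iff)
      then have "(i, x) \<rightarrow>\<^bsub>ZQ G\<^esub> (i', ?x')"
        using in_arcs_imp_in_arcs_ends[OF a] e
        by (auto simp: adj_ZQ_iff i'_def)
      also have "(i', ?x') \<rightarrow>\<^sup>*\<^bsub>ZQ G\<^esub> (j, y)"
        using Cons.prems e
        by (intro Cons.hyps) (auto simp: D.awalk_Cons_iff opposite_steps_def i'_def)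
      finally show ?case .
    qed
  qed
qed

section \<open>The one-way distance\<close>

text \<open>
  By \<open>reachable_ZQ_iff_awalk\<close> this is the least number of opposite steps on an unoriented path from
  \<open>x\<close> to \<open>y\<close>, provided there is one.  It is written \<open>c x y\<close> in the comments.
\<close>
definition opposite_dist :: "'a \<Rightarrow> 'a \<Rightarrow> nat" where
  "opposite_dist x y = (LEAST n. (0, x) \<rightarrow>\<^sup>*\<^bsub>ZQ G\<^esub> (int n, y))"

lemma opposite_dist_le:
  assumes "(i, x) \<rightarrow>\<^sup>*\<^bsub>ZQ G\<^esub> (j, y)"
  shows "i + int (opposite_dist x y) \<le> j"
proof -
  from assms have "i \<le> j" by (rule reachable_ZQ_level)
  moreover have "(0, x) \<rightarrow>\<^sup>*\<^bsub>ZQ G\<^esub> (j - i, y)"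
    using reachable_ZQ_shift[OF assms, of "- i"] by simp
  ultimately have "opposite_dist x y \<le> nat (j - i)"
    unfolding opposite_dist_def by (intro Least_le) simp
  with \<open>i \<le> j\<close> show ?thesis by linarith
qed

end

locale connected_quiver = wf_digraph +
  assumes connected: "connected G"
begin

text \<open>
  An unoriented path in \<open>Q\<close> lifts to \<open>\<int>Q\<close>, where each opposite step goes up one level.
\<close>
lemma ex_reachable_ZQ:
  assumes "x \<in> verts G" and "y \<in> verts G"
  shows "\<exists>n. (0, x) \<rightarrow>\<^sup>*\<^bsub>ZQ G\<^esub> (int n, y)"
proof -
  interpret Z: wf_digraph "ZQ G" by (rule wf_digraph_ZQ)
  have "(x, y) \<in> rtrancl_on (verts G) ((arcs_ends G)\<^sup>s)"
    using connected assms by (simp add: connected_conv)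
  then show ?thesis
  proof (induct rule: rtrancl_on_induct)
    case base
    then have "(0, x) \<rightarrow>\<^sup>*\<^bsub>ZQ G\<^esub> (int 0, x)" by simp
    then show ?case by (rule exI)
  next
    case (step y z)
    then obtain n where n: "(0, x) \<rightarrow>\<^sup>*\<^bsub>ZQ G\<^esub> (int n, y)" by blast
    from step(2) have "(int n, y) \<rightarrow>\<^bsub>ZQ G\<^esub> (int n, z) \<or> (int n, y) \<rightarrow>\<^bsub>ZQ G\<^esub> (int (Suc n), z)"
      by (auto simp: symcl_def adj_ZQ_iff)
    with n show ?case by (meson Z.reachable_adj_trans)
  qed
qed

lemma reachable_opposite_dist:
  assumes "x \<in> verts G" and "y \<in> verts G"
  shows "(i, x) \<rightarrow>\<^sup>*\<^bsub>ZQ G\<^esub> (i + int (opposite_dist x y), y)"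
proof -
  have "(0, x) \<rightarrow>\<^sup>*\<^bsub>ZQ G\<^esub> (int (opposite_dist x y), y)"
    unfolding opposite_dist_def by (rule LeastI_ex[OF ex_reachable_ZQ[OF assms]])
  from reachable_ZQ_shift[OF this, of i] show ?thesis by (simp add: add.commute)
qed

lemma opposite_dist_triangle:
  assumes "x \<in> verts G" and "y \<in> verts G" and "z \<in> verts G"
  shows "opposite_dist x z \<le> opposite_dist x y + opposite_dist y z"
proof -
  interpret Z: wf_digraph "ZQ G" by (rule wf_digraph_ZQ)
  have "(0, x) \<rightarrow>\<^sup>*\<^bsub>ZQ G\<^esub> (0 + int (opposite_dist x y), y)"
    using assms by (intro reachable_opposite_dist)
  also have "\<dots> \<rightarrow>\<^sup>*\<^bsub>ZQ G\<^esub> (0 + int (opposite_dist x y) + int (opposite_dist y z), z)"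
    using assms by (intro reachable_opposite_dist)
  finally show ?thesis
    by (auto dest: opposite_dist_le)
qed

lemma opposite_dist_arrow:
  assumes "x \<rightarrow>\<^bsub>G\<^esub> y"
  shows "opposite_dist x y = 0" and "opposite_dist y x \<le> 1"
proof -
  interpret Z: wf_digraph "ZQ G" by (rule wf_digraph_ZQ)
  have "(0, x) \<rightarrow>\<^sup>*\<^bsub>ZQ G\<^esub> (0, y)" "(0, y) \<rightarrow>\<^sup>*\<^bsub>ZQ G\<^esub> (1, x)"
    using assms by (auto simp: adj_ZQ_iff)
  then show "opposite_dist x y = 0" "opposite_dist y x \<le> 1"
    by (auto dest: opposite_dist_le)
qed

text \<open>
  The two halves of a round trip can be chosen independently, so each is minimal by itself.
\<close>
lemma round_trip_dist_eq:
  assumes "x \<in> verts G" and "y \<in> verts G"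
  shows "round_trip_dist G x y = opposite_dist x y + opposite_dist y x"
  unfolding round_trip_dist_def
proof (rule Least_equality)
  from reachable_opposite_dist[OF assms, of 0] obtain p where
    "pre_digraph.awalk (double_quiver G) x p y" "opposite_steps p = opposite_dist x y"
    by (auto simp: reachable_ZQ_iff_awalk)
  moreover from reachable_opposite_dist[OF assms(2,1), of 0] obtain q where
    "pre_digraph.awalk (double_quiver G) y q x" "opposite_steps q = opposite_dist y x"
    by (auto simp: reachable_ZQ_iff_awalk)
  ultimately show "\<exists>p q. pre_digraph.awalk (double_quiver G) x p y \<and>
      pre_digraph.awalk (double_quiver G) y q x \<and>
      opposite_steps (p @ q) = opposite_dist x y + opposite_dist y x"
    by (intro exI[of _ p] exI[of _ q]) (simp add: opposite_steps_def)
next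
  fix k
  assume "\<exists>p q. pre_digraph.awalk (double_quiver G) x p y \<and>
      pre_digraph.awalk (double_quiver G) y q x \<and> opposite_steps (p @ q) = k"
  then obtain p q where pq: "pre_digraph.awalk (double_quiver G) x p y"
    "pre_digraph.awalk (double_quiver G) y q x"
    and k: "k = opposite_steps p + opposite_steps q"
    by (auto simp: opposite_steps_def)
  from pq have "(0, x) \<rightarrow>\<^sup>*\<^bsub>ZQ G\<^esub> (int (opposite_steps p), y)"
    "(0, y) \<rightarrow>\<^sup>*\<^bsub>ZQ G\<^esub> (int (opposite_steps q), x)"
    by (auto simp: reachable_ZQ_iff_awalk)
  with k show "opposite_dist x y + opposite_dist y x \<le> k"
    by (auto dest!: opposite_dist_le)
qed

lemma finite_balls_if_finite_spheres:
  assumes "x \<in> verts G" and "\<forall>n. finite (round_trip_sphere G x n)"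
  shows "finite {y \<in> verts G. opposite_dist x y + opposite_dist y x \<le> N}"
proof -
  have "{y \<in> verts G. opposite_dist x y + opposite_dist y x \<le> N}
      \<subseteq> (\<Union>n \<le> N. round_trip_sphere G x n)"
    using assms(1) by (auto simp: round_trip_sphere_def round_trip_dist_eq)
  moreover have "finite (\<Union>n \<le> N. round_trip_sphere G x n)"
    using assms(2) by blast
  ultimately show ?thesis by (rule finite_subset)
qed

definition finite_intervals :: bool where
  "finite_intervals \<longleftrightarrow> (\<forall>u \<in> verts (ZQ G). \<forall>v \<in> verts (ZQ G).
     finite {w. u \<rightarrow>\<^sup>*\<^bsub>ZQ G\<^esub> w \<and> w \<rightarrow>\<^sup>*\<^bsub>ZQ G\<^esub> v})"

text \<open>
  If \<open>(k, w)\<close> lies between \<open>(i, y)\<close> and \<open>(j, z)\<close>, then \<open>c y w + c w z \<le> j - i\<close>, and going from \<open>x\<close>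
  to \<open>w\<close> by way of \<open>y\<close> and back by way of \<open>z\<close> bounds the round trip distance from \<open>x\<close> to \<open>w\<close>.
  The base vertex \<open>x\<close> is arbitrary, hence one vertex with finite spheres is enough.
\<close>
lemma finite_intervals_if_finite_spheres:
  assumes x: "x \<in> verts G" and fin: "\<forall>n. finite (round_trip_sphere G x n)"
  shows finite_intervals
  unfolding finite_intervals_def
proof (intro ballI)
  fix u v assume "u \<in> verts (ZQ G)" "v \<in> verts (ZQ G)"
  then obtain i y j z where u: "u = (i, y)" "y \<in> verts G" and v: "v = (j, z)" "z \<in> verts G"
    by (metis surj_pair verts_ZQ_iff)
  interpret Z: wf_digraph "ZQ G" by (rule wf_digraph_ZQ)
  define N where "N = nat (opposite_dist x y + (j - i) + opposite_dist z x)"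
  let ?B = "{w \<in> verts G. opposite_dist x w + opposite_dist w x \<le> N}"
  have "{w. u \<rightarrow>\<^sup>*\<^bsub>ZQ G\<^esub> w \<and> w \<rightarrow>\<^sup>*\<^bsub>ZQ G\<^esub> v} \<subseteq> {i..j} \<times> ?B"
  proof
    fix w' assume "w' \<in> {w. u \<rightarrow>\<^sup>*\<^bsub>ZQ G\<^esub> w \<and> w \<rightarrow>\<^sup>*\<^bsub>ZQ G\<^esub> v}"
    moreover obtain k w where w': "w' = (k, w)" by fastforce
    ultimately have uw: "u \<rightarrow>\<^sup>*\<^bsub>ZQ G\<^esub> (k, w)" and wv: "(k, w) \<rightarrow>\<^sup>*\<^bsub>ZQ G\<^esub> v"
      by auto
    have w: "w \<in> verts G" using Z.reachable_in_verts(2)[OF uw] by simp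
    have "i + opposite_dist y w \<le> k" "k + opposite_dist w z \<le> j"
      using uw wv u v by (auto dest: opposite_dist_le)
    moreover have "opposite_dist x w \<le> opposite_dist x y + opposite_dist y w"
      "opposite_dist w x \<le> opposite_dist w z + opposite_dist z x"
      using x u v w by (auto intro: opposite_dist_triangle)
    ultimately have "opposite_dist x w + opposite_dist w x \<le> N" "i \<le> k" "k \<le> j"
      unfolding N_def by linarith+
    with w w' show "w' \<in> {i..j} \<times> ?B" by simp
  qed
  moreover have "finite ({i..j} \<times> ?B)"
    using finite_balls_if_finite_spheres[OF x fin] by simp
  ultimately show "finite {w. u \<rightarrow>\<^sup>*\<^bsub>ZQ G\<^esub> w \<and> w \<rightarrow>\<^sup>*\<^bsub>ZQ G\<^esub> v}"
    by (rule finite_subset)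
qed

text \<open>
  A shortest round trip of length \<open>n\<close> from \<open>x\<close> through \<open>y\<close> is a path from \<open>(0, x)\<close> to \<open>(n, x)\<close>
  through a copy of \<open>y\<close>.
\<close>
lemma finite_spheres_if_finite_intervals:
  assumes finite_intervals and x: "x \<in> verts G"
  shows "finite (round_trip_sphere G x n)"
proof -
  let ?I = "{w. (0, x) \<rightarrow>\<^sup>*\<^bsub>ZQ G\<^esub> w \<and> w \<rightarrow>\<^sup>*\<^bsub>ZQ G\<^esub> (int n, x)}"
  have "round_trip_sphere G x n \<subseteq> snd ` ?I"
  proof
    fix y assume "y \<in> round_trip_sphere G x n"
    then have y: "y \<in> verts G" and n: "n = opposite_dist x y + opposite_dist y x"
      using x by (auto simp: round_trip_sphere_def round_trip_dist_eq)
    have "(int (opposite_dist x y), y) \<in> ?I"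
      using reachable_opposite_dist[OF x y, of 0]
        reachable_opposite_dist[OF y x, of "int (opposite_dist x y)"] n
      by simp
    then show "y \<in> snd ` ?I" by force
  qed
  moreover have "finite ?I"
    using assms by (auto simp: finite_intervals_def)
  ultimately show ?thesis by (auto intro: finite_subset)
qed

lemma finite_paths_ZQ_iff:
  "(\<forall>u \<in> verts (ZQ G). \<forall>v \<in> verts (ZQ G). finite (paths (ZQ G) u v)) \<longleftrightarrow>
   acyclic (arcs_ends G) \<and> finite_intervals"
  using wf_digraph.finite_paths_iff[OF wf_digraph_ZQ]
  by (simp add: acyclic_ZQ_iff finite_intervals_def)

end

section \<open>Sections given by height functions\<close>

context wf_digraph
begin

definition graph_section :: "('a \<Rightarrow> int) \<Rightarrow> (int \<times> 'a, 'b zarrow) pre_digraph" where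
  "graph_section h = ZQ G \<restriction> ((\<lambda>x. (h x, x)) ` verts G)"

fun zarrow_shift :: "int \<Rightarrow> 'b zarrow \<Rightarrow> 'b zarrow" where
  "zarrow_shift n (Level m a) = Level (n + m) a"
| "zarrow_shift n (Cross m a) = Cross (n + m) a"

text \<open>
  The polarization of \<open>\<int>Q\<close>: it sends an arrow \<open>u \<rightarrow> v\<close> to the corresponding arrow from \<open>v\<close> to the
  inverse translate of \<open>u\<close>.
\<close>
fun zarrow_sigma :: "'b zarrow \<Rightarrow> 'b zarrow" where
  "zarrow_sigma (Level m a) = Cross m a"
| "zarrow_sigma (Cross m a) = Level (m + 1) a"

text \<open>
  Commuting with the translations forces \<open>(n, v)\<close> to go to the copy of \<open>v\<close> moved up by \<open>n\<close> levels.
  A crossing arrow of \<open>\<int>Q'\<close> over an arrow \<open>b : u \<rightarrow> v\<close> of \<open>Q'\<close> runs from \<open>v\<close> to the inverse translate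
  of \<open>u\<close>, as does \<open>zarrow_sigma b\<close>.  One map serves all sections.
\<close>
definition section_iso ::
  "(int \<times> int \<times> 'a, 'b zarrow zarrow, int \<times> 'a, 'b zarrow) digraph_isomorphism" where
  "section_iso = \<lparr>
     iso_verts = (\<lambda>(n, m, x). (n + m, x)),
     iso_arcs = (\<lambda>e. case e of
        Level n b \<Rightarrow> zarrow_shift n b | Cross n b \<Rightarrow> zarrow_shift n (zarrow_sigma b)),
     iso_head = head (ZQ G),
     iso_tail = tail (ZQ G)\<rparr>"

lemma zarrow_shift_0 [simp]: "zarrow_shift 0 b = b"
  by (cases b) simp_all

lemma wf_digraph_graph_section: "wf_digraph (graph_section h)"
  unfolding graph_section_def by (rule wf_digraph.wellformed_induce_subgraph[OF wf_digraph_ZQ])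

lemma verts_graph_section: "verts (graph_section h) = (\<lambda>x. (h x, x)) ` verts G"
  by (simp add: graph_section_def)

lemma arcs_graph_section_iff:
  "Level m a \<in> arcs (graph_section h) \<longleftrightarrow>
     a \<in> arcs G \<and> m = h (tail G a) \<and> m = h (head G a)"
  "Cross m a \<in> arcs (graph_section h) \<longleftrightarrow>
     a \<in> arcs G \<and> m = h (head G a) \<and> m + 1 = h (tail G a)"
  by (auto simp: graph_section_def)

lemma ends_graph_section [simp]:
  "tail (graph_section h) = tail (ZQ G)" "head (graph_section h) = head (ZQ G)"
  by (simp_all add: graph_section_def)

text \<open>
  The hypothesis on \<open>h\<close> says that of the infinitely many arrows of \<open>\<int>Q\<close> lying over an arrow \<open>a\<close> of
  \<open>Q\<close>, exactly one joins two vertices of the section: a level arrow if \<open>h\<close> agrees at both ends of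
  \<open>a\<close>, and a crossing arrow otherwise.  The other arrows over \<open>a\<close> are obtained from it by
  shifting and by \<open>zarrow_sigma\<close>.
\<close>
lemma section_iso_isomorphism:
  assumes h: "\<And>a. a \<in> arcs G \<Longrightarrow> h (head G a) \<le> h (tail G a) \<and> h (tail G a) \<le> h (head G a) + 1"
  shows "translation_quiver_isomorphism (graph_section h) G section_iso"
proof -
  let ?S = "graph_section h" and ?f = section_iso
  interpret S: wf_digraph ?S by (rule wf_digraph_graph_section)
  have "inj_on (iso_verts ?f) (verts (ZQ ?S))"
    by (auto simp: inj_on_def section_iso_def ZQ_def[of ?S] verts_graph_section)
  moreover have "inj_on (iso_arcs ?f) (arcs (ZQ ?S))"
  proof (rule inj_onI)
    fix e e' assume "e \<in> arcs (ZQ ?S)" "e' \<in> arcs (ZQ ?S)" "iso_arcs ?f e = iso_arcs ?f e'"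
    then show "e = e'"
      by (cases e rule: zarrow.exhaust; cases e' rule: zarrow.exhaust;
          rename_tac n b n' b'; case_tac b; case_tac b')
        (auto simp: section_iso_def arcs_graph_section_iff)
  qed
  moreover have "iso_verts ?f (tail (ZQ ?S) e) = iso_tail ?f (iso_arcs ?f e) \<and>
      iso_verts ?f (head (ZQ ?S) e) = iso_head ?f (iso_arcs ?f e)" for e
    by (cases e; rename_tac n b; case_tac b) (simp_all add: section_iso_def)
  ultimately have "pre_digraph.digraph_isomorphism (ZQ ?S) ?f"
    by (simp add: pre_digraph.digraph_isomorphism_def S.wf_digraph_ZQ)
  moreover have "iso_verts ?f ` verts (ZQ ?S) = verts (ZQ G)"
  proof (intro set_eqI iffI)
    fix v assume "v \<in> verts (ZQ G)"
    then obtain i x where v: "v = (i, x)" "x \<in> verts G" by (cases v) auto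
    then have "(i - h x, h x, x) \<in> verts (ZQ ?S)"
      by (simp add: verts_graph_section)
    moreover have "v = iso_verts ?f (i - h x, h x, x)"
      using v by (simp add: section_iso_def)
    ultimately show "v \<in> iso_verts ?f ` verts (ZQ ?S)" by (rule rev_image_eqI)
  qed (auto simp: ZQ_def[of ?S] verts_graph_section section_iso_def)
  moreover have "iso_arcs ?f ` arcs (ZQ ?S) = arcs (ZQ G)"
  proof (intro set_eqI iffI)
    fix e assume e: "e \<in> arcs (ZQ G)"
    have "\<exists>e' \<in> arcs (ZQ ?S). e = iso_arcs ?f e'"
    proof (cases e)
      case (Level i a)
      with e have a: "a \<in> arcs G" by simp
      let ?m = "h (head G a)"
      show ?thesis
      proof (cases "h (tail G a) = ?m")
        case True
        with a Level show ?thesis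
          by (intro bexI[of _ "Level (i - ?m) (Level ?m a)"])
            (simp_all add: section_iso_def arcs_graph_section_iff)
      next
        case False
        with h[OF a] have "h (tail G a) = ?m + 1" by linarith
        with a Level show ?thesis
          by (intro bexI[of _ "Cross (i - ?m - 1) (Cross ?m a)"])
            (simp_all add: section_iso_def arcs_graph_section_iff)
      qed
    next
      case (Cross i a)
      with e have a: "a \<in> arcs G" by simp
      let ?m = "h (head G a)"
      show ?thesis
      proof (cases "h (tail G a) = ?m")
        case True
        with a Cross show ?thesis
          by (intro bexI[of _ "Cross (i - ?m) (Level ?m a)"])
            (simp_all add: section_iso_def arcs_graph_section_iff)
      next
        case False
        with h[OF a] have "h (tail G a) = ?m + 1" by linarith
        with a Cross show ?thesis
          by (intro bexI[of _ "Level (i - ?m) (Cross ?m a)"])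
            (simp_all add: section_iso_def arcs_graph_section_iff)
      qed
    qed
    then show "e \<in> iso_arcs ?f ` arcs (ZQ ?S)" by blast
  next
    fix e assume "e \<in> iso_arcs ?f ` arcs (ZQ ?S)"
    then obtain e' where "e' \<in> arcs (ZQ ?S)" "e = iso_arcs ?f e'" by blast
    then show "e \<in> arcs (ZQ G)"
      by (cases e'; rename_tac n b; case_tac b)
        (simp_all add: section_iso_def arcs_graph_section_iff)
  qed
  then have "arcs (app_iso ?f (ZQ ?S)) = arcs (ZQ G)" by simp
  ultimately have "app_iso ?f (ZQ ?S) = ZQ G"
    by (intro pre_digraph.equality) (simp_all add: section_iso_def)
  moreover have "iso_verts ?f (translation v) = translation (iso_verts ?f v)" for v
    by (cases v) (auto simp: section_iso_def)
  ultimately show ?thesis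
    using \<open>pre_digraph.digraph_isomorphism (ZQ ?S) ?f\<close>
    by (simp add: translation_quiver_isomorphism_def)
qed

lemma is_section_graph_section:
  assumes "\<And>a. a \<in> arcs G \<Longrightarrow> h (head G a) \<le> h (tail G a) \<and> h (tail G a) \<le> h (head G a) + 1"
  shows "is_section G (graph_section h)"
  unfolding is_section_def
proof (intro conjI exI[of _ section_iso])
  show "induced_subgraph (graph_section h) (ZQ G)"
    unfolding graph_section_def
    by (intro wf_digraph.induced_induce[OF wf_digraph_ZQ]) auto
  show "translation_quiver_isomorphism (graph_section h) G section_iso"
    using assms by (rule section_iso_isomorphism)
qed (auto simp: section_iso_def)

lemma adj_graph_section_iff:
  "(h x, x) \<rightarrow>\<^bsub>graph_section h\<^esub> (h y, y) \<longleftrightarrow>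
     h y = h x \<and> x \<rightarrow>\<^bsub>G\<^esub> y \<or> h y = h x + 1 \<and> y \<rightarrow>\<^bsub>G\<^esub> x"
  (is "?L \<longleftrightarrow> ?R")
proof
  assume ?L
  then have "(h x, x) \<rightarrow>\<^bsub>ZQ G\<^esub> (h y, y)"
    unfolding graph_section_def by (rule dominates_induce_subgraphD)
  then show ?R by (simp add: adj_ZQ_iff)
next
  assume ?R
  then have "(h x, x) \<rightarrow>\<^bsub>ZQ G\<^esub> (h y, y)" and "x \<in> verts G" "y \<in> verts G"
    by (auto simp: adj_ZQ_iff dest: adj_in_verts)
  moreover from this(1) obtain e where
    e: "e \<in> arcs (ZQ G)" "tail (ZQ G) e = (h x, x)" "head (ZQ G) e = (h y, y)"
    by (rule reachableE)
  ultimately have "e \<in> arcs (graph_section h)"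
    by (simp add: graph_section_def)
  from wf_digraph.in_arcs_imp_in_arcs_ends[OF wf_digraph_graph_section this]
  show ?L by (simp add: e)
qed

end

section \<open>The section halfway between the successors and the predecessors of a vertex\<close>

context connected_quiver
begin

lemma connected_graph_section:
  assumes h: "\<And>x y. x \<rightarrow>\<^bsub>G\<^esub> y \<Longrightarrow> h y \<le> h x \<and> h x \<le> h y + 1"
  shows "connected (graph_section h)"
proof -
  let ?S = "graph_section h"
  have "((h x, x), (h y, y)) \<in> rtrancl_on (verts ?S) ((arcs_ends ?S)\<^sup>s)"
    if "x \<in> verts G" "y \<in> verts G" for x y
  proof -
    have "(x, y) \<in> rtrancl_on (verts G) ((arcs_ends G)\<^sup>s)"
      using connected that by (simp add: connected_conv)
    then show ?thesis
    proof (induct rule: rtrancl_on_induct)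
      case base
      then show ?case by (auto simp: verts_graph_section)
    next
      case (step y z)
      have adj: "(h v, v) \<rightarrow>\<^bsub>?S\<^esub> (h w, w) \<or> (h w, w) \<rightarrow>\<^bsub>?S\<^esub> (h v, v)" if "v \<rightarrow>\<^bsub>G\<^esub> w" for v w
        using h[OF that] that by (simp add: adj_graph_section_iff) linarith
      from step(2) have "((h y, y), (h z, z)) \<in> (arcs_ends ?S)\<^sup>s"
        using adj[of y z] adj[of z y] by (force simp: symcl_def)
      moreover have "(h z, z) \<in> verts ?S"
        using step(4) by (simp add: verts_graph_section)
      ultimately show ?case
        using step(5) by (blast intro: rtrancl_on_into_rtrancl_on)
    qed
  qed
  moreover have "verts G \<noteq> {}"
    using connected by (simp add: connected_conv)
  ultimately show ?thesis
    by (auto simp: connected_conv verts_graph_section)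
qed

text \<open>
  The rounded mean of \<open>c b x\<close> and \<open>- c x b\<close>, the lowest level at which \<open>x\<close> is a successor of \<open>(0, b)\<close>
  and the highest level at which it is a predecessor.
\<close>
definition midway :: "'a \<Rightarrow> 'a \<Rightarrow> int" where
  "midway b x = (int (opposite_dist b x) - int (opposite_dist x b)) div 2"

text \<open>
  Along an arrow \<open>x \<rightarrow> y\<close>, each of \<open>c b\<close> and \<open>- c _ b\<close> drops by at most one and does not rise, so
  their sum drops by \<open>0\<close>, \<open>1\<close> or \<open>2\<close>, and its rounded half by \<open>0\<close> or \<open>1\<close>.
\<close>
lemma midway_arrow:
  assumes b: "b \<in> verts G" and xy: "x \<rightarrow>\<^bsub>G\<^esub> y"
  shows "midway b y \<le> midway b x \<and> midway b x \<le> midway b y + 1"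
proof -
  have "x \<in> verts G" "y \<in> verts G" using xy adj_in_verts by blast+
  then have "opposite_dist b y \<le> opposite_dist b x" "opposite_dist b x \<le> opposite_dist b y + 1"
    "opposite_dist x b \<le> opposite_dist y b" "opposite_dist y b \<le> opposite_dist x b + 1"
    using b opposite_dist_arrow[OF xy] opposite_dist_triangle[of b x y]
      opposite_dist_triangle[of b y x] opposite_dist_triangle[of x y b]
      opposite_dist_triangle[of y x b] by linarith+
  then show ?thesis unfolding midway_def by presburger
qed

lemma reachable_ZQ_if_graph_section_path:
  assumes "(u, v) \<in> (arcs_ends (graph_section h))\<^sup>*" and "u \<in> verts (graph_section h)"
  shows "u \<rightarrow>\<^sup>*\<^bsub>ZQ G\<^esub> v"
proof -
  have "u \<rightarrow>\<^sup>*\<^bsub>graph_section h\<^esub> v"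
    using assms wf_digraph.reachable_conv'[OF wf_digraph_graph_section] by blast
  then show ?thesis
    unfolding graph_section_def
    by (rule wf_digraph.reachable_induce_subgraphD[OF wf_digraph_ZQ]) auto
qed

text \<open>
  Write \<open>h\<close> for \<open>midway b\<close> and let \<open>u = (h x, x)\<close>.  If \<open>(h y, y)\<close> is reachable from \<open>u\<close>, then
  \<open>c x y \<le> h y - h x\<close>, so \<open>c b y \<le> h y + K\<close> with \<open>K = c b x - h x\<close>.  Together with
  \<open>2 * h y \<le> c b y - c y b\<close> this gives \<open>c b y + c y b \<le> 2 * K\<close>.  The bound for the
  predecessors is symmetric, up to the rounding error in \<open>h\<close>.
\<close>
lemma finite_midway_reach:
  assumes b: "b \<in> verts G" and fin: finite_intervals and u: "u \<in> verts (graph_section (midway b))"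
  shows "finite {v. (u, v) \<in> (arcs_ends (graph_section (midway b)))\<^sup>*}" (is "finite ?V")
    and "finite {v. (v, u) \<in> (arcs_ends (graph_section (midway b)))\<^sup>*}" (is "finite ?W")
proof -
  let ?h = "midway b" and ?S = "graph_section (midway b)"
  let ?B = "\<lambda>N. {y \<in> verts G. opposite_dist b y + opposite_dist y b \<le> N}"
  obtain x where x: "u = (?h x, x)" "x \<in> verts G"
    using u by (auto simp: verts_graph_section)
  have B: "finite ((\<lambda>y. (?h y, y)) ` ?B N)" for N
    using finite_balls_if_finite_spheres[OF b] finite_spheres_if_finite_intervals[OF fin b] by simp
  define N where "N = nat (2 * (opposite_dist b x - ?h x))"
  have "?V \<subseteq> (\<lambda>y. (?h y, y)) ` ?B N"
  proof
    fix v assume "v \<in> ?V"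
    then have "v \<in> verts ?S"
      using u wf_digraph.reachable_conv'[OF wf_digraph_graph_section]
        wf_digraph.reachable_in_verts(2)[OF wf_digraph_graph_section] by blast
    then obtain y where y: "v = (?h y, y)" "y \<in> verts G"
      by (auto simp: verts_graph_section)
    with \<open>v \<in> ?V\<close> x u have "?h x + opposite_dist x y \<le> ?h y"
      by (auto dest!: reachable_ZQ_if_graph_section_path opposite_dist_le)
    moreover have "int (opposite_dist b y) \<le> int (opposite_dist b x) + int (opposite_dist x y)"
      using opposite_dist_triangle[of b x y] b x y by simp
    moreover have "2 * ?h y \<le> int (opposite_dist b y) - int (opposite_dist y b)"
      unfolding midway_def by presburger
    ultimately have "int (opposite_dist b y + opposite_dist y b) \<le> 2 * (opposite_dist b x - ?h x)"
      by simp
    then have "opposite_dist b y + opposite_dist y b \<le> N"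
      unfolding N_def by linarith
    with y show "v \<in> (\<lambda>y. (?h y, y)) ` ?B N" by blast
  qed
  then show "finite ?V" using B by (rule finite_subset)
  define M where "M = nat (2 * (?h x + opposite_dist x b) + 1)"
  have "?W \<subseteq> insert u ((\<lambda>y. (?h y, y)) ` ?B M)"
  proof
    fix v assume v: "v \<in> ?W"
    show "v \<in> insert u ((\<lambda>y. (?h y, y)) ` ?B M)"
    proof (cases "v = u")
      case False
      with v have "v \<rightarrow>\<^sup>+\<^bsub>?S\<^esub> u" by (auto dest: rtranclD)
      then have vS: "v \<in> verts ?S"
        by (rule wf_digraph.reachable1_in_verts(1)[OF wf_digraph_graph_section])
      then obtain y where y: "v = (?h y, y)" "y \<in> verts G"
        by (auto simp: verts_graph_section)
      with v x vS have "?h y + opposite_dist y x \<le> ?h x"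
        by (auto dest!: reachable_ZQ_if_graph_section_path opposite_dist_le)
      moreover have "int (opposite_dist y b) \<le> int (opposite_dist y x) + int (opposite_dist x b)"
        using opposite_dist_triangle[of y x b] b x y by simp
      moreover have "int (opposite_dist b y) - int (opposite_dist y b) \<le> 2 * ?h y + 1"
        unfolding midway_def by presburger
      ultimately have
        "int (opposite_dist b y + opposite_dist y b) \<le> 2 * (?h x + opposite_dist x b) + 1"
        by simp
      then have "opposite_dist b y + opposite_dist y b \<le> M"
        unfolding M_def by linarith
      with y show ?thesis by blast
    qed simp
  qed
  then show "finite ?W" using B by (meson finite_insert finite_subset)
qed

lemma acyclic_graph_section:
  assumes "acyclic (arcs_ends G)"
  shows "acyclic (arcs_ends (graph_section h))"
proof -
  have "arcs_ends (graph_section h) \<subseteq> arcs_ends (ZQ G)"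
    unfolding graph_section_def by (auto dest: dominates_induce_subgraphD)
  moreover have "acyclic (arcs_ends (ZQ G))"
    using assms by (simp add: acyclic_ZQ_iff)
  ultimately show ?thesis
    by (rule acyclic_subset[rotated])
qed

lemma strongly_locally_finite_midway:
  assumes b: "b \<in> verts G" and acyc: "acyclic (arcs_ends G)" and fin: finite_intervals
  shows "strongly_locally_finite (graph_section (midway b))"
  unfolding strongly_locally_finite_def
proof (intro conjI ballI notI)
  let ?h = "midway b" and ?S = "graph_section (midway b)"
  interpret S: wf_digraph ?S by (rule wf_digraph_graph_section)
  show "connected ?S"
    using b by (intro connected_graph_section midway_arrow)
  show "finite {v. u \<rightarrow>\<^bsub>?S\<^esub> v \<or> v \<rightarrow>\<^bsub>?S\<^esub> u}" if "u \<in> verts ?S" for u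
  proof (rule finite_subset)
    show "{v. u \<rightarrow>\<^bsub>?S\<^esub> v \<or> v \<rightarrow>\<^bsub>?S\<^esub> u} \<subseteq>
        {v. (u, v) \<in> (arcs_ends ?S)\<^sup>*} \<union> {v. (v, u) \<in> (arcs_ends ?S)\<^sup>*}"
      by blast
  qed (use finite_midway_reach[OF b fin that] in blast)
  have acyc_S: "acyclic (arcs_ends ?S)"
    using acyc by (rule acyclic_graph_section)
  {
    assume "\<exists>a :: nat \<Rightarrow> int \<times> 'a. \<forall>i. a i \<rightarrow>\<^bsub>?S\<^esub> a (Suc i)"
    then obtain a :: "nat \<Rightarrow> int \<times> 'a" where a: "\<And>i. a i \<rightarrow>\<^bsub>?S\<^esub> a (Suc i)" by blast
    have "(a 0, a n) \<in> (arcs_ends ?S)\<^sup>*" for n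
      by (induct n) (auto intro: a rtrancl_into_rtrancl)
    then have "range a \<subseteq> {v. (a 0, v) \<in> (arcs_ends ?S)\<^sup>*}" by blast
    moreover have "a 0 \<in> verts ?S" using a S.adj_in_verts by blast
    ultimately have "finite (range a)"
      using finite_midway_reach(1)[OF b fin] by (meson finite_subset)
    with chain_range_infinite[of _ a, OF acyc_S] a show False by blast
  next
    assume "\<exists>a :: nat \<Rightarrow> int \<times> 'a. \<forall>i. a (Suc i) \<rightarrow>\<^bsub>?S\<^esub> a i"
    then obtain a :: "nat \<Rightarrow> int \<times> 'a" where a: "\<And>i. a (Suc i) \<rightarrow>\<^bsub>?S\<^esub> a i" by blast
    have "(a n, a 0) \<in> (arcs_ends ?S)\<^sup>*" for n
      by (induct n) (auto intro: a converse_rtrancl_into_rtrancl)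
    then have "range a \<subseteq> {v. (v, a 0) \<in> (arcs_ends ?S)\<^sup>*}" by blast
    moreover have "a 0 \<in> verts ?S" using a S.adj_in_verts by blast
    ultimately have "finite (range a)"
      using finite_midway_reach(2)[OF b fin] by (meson finite_subset)
    moreover have "acyclic ((arcs_ends ?S)\<inverse>)"
      using acyc_S by (simp add: acyclic_converse)
    then have "infinite (range a)"
      by (rule chain_range_infinite) (simp only: converse_iff a)
    ultimately show False by blast
  }
qed

end

section \<open>Path finiteness from a strongly locally finite section\<close>

text \<open>
  The descent is lexicographic: a crossing arrow lowers the number of levels that remain below the
  target level \<open>n\<close>, and a level arrow keeps it and advances along an arrow of the quiver.
\<close>
lemma (in wf_digraph) finite_paths_ZQ_if_strongly_locally_finite:
  assumes slf: "strongly_locally_finite G" and "u \<in> verts (ZQ G)"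
  shows "finite (paths (ZQ G) u v)"
proof -
  interpret Z: wf_digraph "ZQ G" by (rule wf_digraph_ZQ)
  obtain n y where v: "v = (n, y)" by fastforce
  let ?R = "less_than <*lex*> (arcs_ends G)\<inverse>"
  have "wf ((arcs_ends G)\<inverse>)"
    using slf by (auto simp: strongly_locally_finite_def wf_iff_no_infinite_down_chain)
  \<comment> \<open>The truncation by \<open>nat\<close> is harmless: a vertex above level \<open>n\<close> does not reach \<open>v\<close>.\<close>
  then have "wf (inv_image ?R (\<lambda>(i, x). (nat (n - i), x)))"
    by (auto intro: wf_inv_image wf_lex_prod)
  moreover have "{(w, u). u \<rightarrow>\<^bsub>ZQ G\<^esub> w \<and> w \<rightarrow>\<^sup>*\<^bsub>ZQ G\<^esub> v} \<subseteq>
      inv_image ?R (\<lambda>(i, x). (nat (n - i), x))"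
    by (auto simp: v adj_ZQ_iff dest!: reachable_ZQ_level)
  ultimately have "wf {(w, u). u \<rightarrow>\<^bsub>ZQ G\<^esub> w \<and> w \<rightarrow>\<^sup>*\<^bsub>ZQ G\<^esub> v}"
    by (rule wf_subset)
  moreover have "finite {w. u \<rightarrow>\<^bsub>ZQ G\<^esub> w}" if "u \<in> verts (ZQ G)" for u
  proof -
    obtain i x where u: "u = (i, x)" by fastforce
    let ?N = "{y. x \<rightarrow>\<^bsub>G\<^esub> y \<or> y \<rightarrow>\<^bsub>G\<^esub> x}"
    have "finite ({i, i + 1} \<times> ?N)"
      using slf that u by (auto simp: strongly_locally_finite_def)
    moreover have "{w. u \<rightarrow>\<^bsub>ZQ G\<^esub> w} \<subseteq> {i, i + 1} \<times> ?N"
      by (auto simp: u adj_ZQ_iff)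
    ultimately show ?thesis by (rule rev_finite_subset)
  qed
  ultimately show ?thesis
    using assms(2) by (rule Z.finite_paths_if_wf)
qed

lemma finite_paths_if_strongly_locally_finite_section:
  assumes sec: "is_section Q Q'" and slf: "strongly_locally_finite Q'"
    and uv: "u \<in> verts (ZQ Q)" "v \<in> verts (ZQ Q)"
  shows "finite (paths (ZQ Q) u v)"
proof -
  from sec have "wf_digraph Q'"
    by (auto simp: is_section_def dest: wf_digraphI_induced)
  then interpret Q': wf_digraph Q' .
  interpret Z: wf_digraph "ZQ Q'" by (rule Q'.wf_digraph_ZQ)
  from sec obtain f where iso: "Z.digraph_isomorphism f" and f: "app_iso f (ZQ Q') = ZQ Q"
    by (auto simp: is_section_def translation_quiver_isomorphism_def)
  from uv obtain u' v' where "u = iso_verts f u'" "v = iso_verts f v'"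
    "u' \<in> verts (ZQ Q')" "v' \<in> verts (ZQ Q')"
    unfolding f[symmetric] by auto
  with Z.finite_paths_app_iso[OF iso] Q'.finite_paths_ZQ_if_strongly_locally_finite[OF slf]
  show ?thesis by (simp add: f)
qed

theorem theorem1p1:
  fixes Q :: "('a,'b) pre_digraph"
  assumes "wf_digraph Q" and "connected Q"
  shows
    "((\<not> (\<exists>p. oriented_cycle Q p)) \<and> (\<exists>x \<in> verts Q. \<forall>n. finite (round_trip_sphere Q x n))
      \<longleftrightarrow> (\<not> (\<exists>p. oriented_cycle Q p)) \<and> (\<forall>x \<in> verts Q. \<forall>n. finite (round_trip_sphere Q x n)))
   \<and> ((\<not> (\<exists>p. oriented_cycle Q p)) \<and> (\<forall>x \<in> verts Q. \<forall>n. finite (round_trip_sphere Q x n))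
      \<longleftrightarrow> (\<forall>u \<in> verts (ZQ Q). \<forall>v \<in> verts (ZQ Q). finite (paths (ZQ Q) u v)))
   \<and> ((\<forall>u \<in> verts (ZQ Q). \<forall>v \<in> verts (ZQ Q). finite (paths (ZQ Q) u v))
      \<longleftrightarrow> (\<exists>Q'. is_section Q Q' \<and> strongly_locally_finite Q'))"
proof -
  interpret connected_quiver Q
    using assms by (simp add: connected_quiver_def connected_quiver_axioms_def)
  let ?paths = "\<forall>u \<in> verts (ZQ Q). \<forall>v \<in> verts (ZQ Q). finite (paths (ZQ Q) u v)"
  let ?section = "\<exists>Q'. is_section Q Q' \<and> strongly_locally_finite Q'"
  obtain b where b: "b \<in> verts Q"
    using connected by (auto simp: connected_conv)
  have cycles: "\<not> (\<exists>p. oriented_cycle Q p) \<longleftrightarrow> acyclic (arcs_ends Q)"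
    by (simp add: ex_oriented_cycle_iff)
  have some: "(\<exists>x \<in> verts Q. \<forall>n. finite (round_trip_sphere Q x n)) \<longleftrightarrow> finite_intervals"
    using b finite_intervals_if_finite_spheres finite_spheres_if_finite_intervals by blast
  have all: "(\<forall>x \<in> verts Q. \<forall>n. finite (round_trip_sphere Q x n)) \<longleftrightarrow> finite_intervals"
    using b finite_intervals_if_finite_spheres finite_spheres_if_finite_intervals by blast
  have "?section" if "?paths"
  proof (intro exI conjI)
    from that have "acyclic (arcs_ends Q)" finite_intervals
      by (simp_all add: finite_paths_ZQ_iff)
    then show "strongly_locally_finite (graph_section (midway b))"
      by (rule strongly_locally_finite_midway[OF b])
    show "is_section Q (graph_section (midway b))"
      using midway_arrow[OF b] in_arcs_imp_in_arcs_ends by (intro is_section_graph_section) blast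
  qed
  moreover have "?paths" if "?section"
    using that finite_paths_if_strongly_locally_finite_section by blast
  ultimately have "?paths \<longleftrightarrow> ?section" by blast
  then show ?thesis
    unfolding cycles some all finite_paths_ZQ_iff by blast
qed

end
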